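(* In the polynomial ring $(F_q[X_1,X_2,\ldots,X_k],+,\cdot)$ over the finite field $F_q$, the ideal $\langle f_1(X_1),f_2(X_2),\ldots,f_k(X_k)\rangle$ generated by $f_1(X_1),f_2(X_2),\ldots,f_k(X_k)$ (at most one of which is non constant) is an IP$^*$-set in the corresponding additive group $(F_q[X_1,X_2,\ldots,X_k],+)$.
   Context: Here $F_q$ denotes the finite field of characteristic $q$, $k$ is a positive integer, and each $f_i(X_i)$ is a polynomial over $F_q$ in the single variable $X_i$. For a semigroup $S$ (written additively), a subset $A\subseteq S$ is called an IP-set if there is a sequence $\langle x_n\rangle_{n=1}^{\infty}$ in $S$ such that $\sum_{n\in F}x_n\in A$ for every nonempty finite subset $F$ of $\mathbb{N}$. A subset $A\subseteq S$ is called an IP$^*$-set if it meets every IP-set in $S$.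
   Formalization: The generators f_1(X_1),…,f_k(X_k) are all assumed to be nonzero polynomials; without this the claim fails, e.g. for k=1 and f_1=0 the ideal {0} misses the IP-set of finite sums of the powers X_1^n. *)

theory Defs
  imports
    "HOL-Library.Poly_Mapping"
    "HOL-Computational_Algebra.Polynomial"
begin

text \<open>
  The polynomial ring over \<open>'a\<close> in variables indexed by the finite type \<open>'n\<close>: a polynomial maps each
  exponent vector, with finite support, to its coefficient.
\<close>

type_synonym ('n, 'a) mpoly = "('n \<Rightarrow>\<^sub>0 nat) \<Rightarrow>\<^sub>0 'a"

definition mconst :: "'a::zero \<Rightarrow> ('n, 'a) mpoly" where
  "mconst c = Poly_Mapping.single 0 c"

definition mvar :: "'n \<Rightarrow> ('n, 'a::zero_neq_one) mpoly" where
  "mvar i = Poly_Mapping.single (Poly_Mapping.single i 1) 1"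

text \<open>The univariate polynomial \<open>p\<close> evaluated at the variable \<open>X\<^sub>i\<close>, i.e. \<open>p(X\<^sub>i)\<close>.\<close>

definition poly_in_var :: "'a::comm_ring_1 poly \<Rightarrow> 'n \<Rightarrow> ('n, 'a) mpoly" where
  "poly_in_var p i = poly (map_poly mconst p) (mvar i)"

text \<open>Ideals of a commutative ring are its submodules as a module over itself.\<close>

interpretation ring_module: module "(*) :: 'a::comm_ring_1 \<Rightarrow> 'a \<Rightarrow> 'a"
  by unfold_locales (simp_all add: algebra_simps)

definition ideal_generated :: "'a::comm_ring_1 set \<Rightarrow> 'a set" where
  "ideal_generated S = ring_module.span S"

text \<open>
  The notions are needed only for a commutative additive structure, so the order of summation is
  immaterial.
\<close>

definition IP_set :: "'s::comm_monoid_add set \<Rightarrow> bool" where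
  "IP_set A \<longleftrightarrow> (\<exists>x :: nat \<Rightarrow> 's. \<forall>F. finite F \<and> F \<noteq> {} \<longrightarrow> (\<Sum>n\<in>F. x n) \<in> A)"

definition IP_star_set :: "'s::comm_monoid_add set \<Rightarrow> bool" where
  "IP_star_set A \<longleftrightarrow> (\<forall>B. IP_set B \<longrightarrow> A \<inter> B \<noteq> {})"

end

theory Submission
  imports Defs "HOL-Library.FuncSet"
begin

text \<open>
  The ideal \<open>I\<close> generated by nonzero polynomials \<open>f\<^sub>i(X\<^sub>i)\<close>, one for each variable, has finite index in
  the polynomial ring over a finite field. Division with remainder by \<open>f\<^sub>i\<close> leaves only finitely many
  residues of powers of \<open>X\<^sub>i\<close>; monomials are products of such powers, one for each of the finitely
  many variables, so they too have only finitely many residues; and polynomials are combinations of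
  monomials with coefficients from a finite field, so finitely many residues remain
  (\<open>finite_modulo_univ\<close>).

  A subgroup of finite index is an IP\<open>\<^sup>*\<close>-set by the pigeonhole principle: among the partial sums
  \<open>\<Sum>j<n. x\<^sub>j\<close> of any sequence, two lie in the same coset, and their difference is a sum of the \<open>x\<^sub>j\<close>
  over a nonempty finite set of indices which lies in the subgroup (\<open>IP_star_set_if_finite_index\<close>).
\<close>

section \<open>Subgroups of finite index\<close>

text \<open>
  For a subgroup \<open>I\<close> this says that \<open>S\<close> meets only finitely many cosets of \<open>I\<close>. With representatives
  in place of a quotient, residues are added and multiplied inside the ring itself.
\<close>

definition finite_modulo :: "'s::ab_group_add set \<Rightarrow> 's set \<Rightarrow> bool" where
  "finite_modulo I S \<longleftrightarrow> (\<exists>T. finite T \<and> (\<forall>s\<in>S. \<exists>t\<in>T. s - t \<in> I))"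

lemma finite_moduloI:
  assumes "finite T" "\<And>s. s \<in> S \<Longrightarrow> \<exists>t\<in>T. s - t \<in> I"
  shows "finite_modulo I S"
  using assms unfolding finite_modulo_def by blast

lemma IP_star_set_if_finite_index:
  fixes I :: "'s::ab_group_add set"
  assumes diff: "\<And>x y. x \<in> I \<Longrightarrow> y \<in> I \<Longrightarrow> x - y \<in> I"
    and fin: "finite_modulo I UNIV"
  shows "IP_star_set I"
  unfolding IP_star_set_def
proof (intro allI impI)
  fix B :: "'s set"
  assume "IP_set B"
  then obtain x :: "nat \<Rightarrow> 's" where x: "\<And>F. finite F \<Longrightarrow> F \<noteq> {} \<Longrightarrow> (\<Sum>n\<in>F. x n) \<in> B"
    unfolding IP_set_def by blast
  obtain T where T: "finite T" "\<And>s. \<exists>t\<in>T. s - t \<in> I"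
    using fin unfolding finite_modulo_def by blast
  obtain r where r: "\<And>s. r s \<in> T" "\<And>s. s - r s \<in> I"
    using T(2) by metis
  define S where "S n = (\<Sum>j<n. x j)" for n
  \<comment> \<open>Pigeonhole: infinitely many partial sums share the finitely many representatives in \<open>T\<close>.\<close>
  have "finite (range (\<lambda>n. r (S n)))"
    by (rule finite_subset[OF _ T(1)]) (use r(1) in auto)
  then have "\<not> inj (\<lambda>n. r (S n))"
    using finite_imageD infinite_UNIV_nat by blast
  then obtain m n where mn: "m < n" "r (S m) = r (S n)"
    unfolding inj_def by (metis nat_neq_iff)
  have "S n = S m + (\<Sum>j\<in>{m..<n}. x j)"
    unfolding S_def using mn(1)
    by (metis atLeast0LessThan less_imp_le sum.atLeastLessThan_concat zero_le)
  then have "(\<Sum>j\<in>{m..<n}. x j) = (S n - r (S n)) - (S m - r (S m))"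
    using mn(2) by simp
  then have "(\<Sum>j\<in>{m..<n}. x j) \<in> I"
    using diff r(2) by presburger
  moreover have "(\<Sum>j\<in>{m..<n}. x j) \<in> B"
    using x mn(1) by simp
  ultimately show "I \<inter> B \<noteq> {}" by blast
qed

section \<open>Products of residues\<close>

text \<open>
  Residues multiply because \<open>a b - s t = a (b - t) + t (a - s)\<close>, and both summands lie in an ideal
  that contains \<open>a - s\<close> and \<open>b - t\<close>.
\<close>

lemma finite_modulo_times:
  fixes I :: "'r::comm_ring_1 set"
  assumes I: "ring_module.subspace I" and A: "finite_modulo I A" and B: "finite_modulo I B"
  shows "finite_modulo I {a * b | a b. a \<in> A \<and> b \<in> B}"
proof -
  obtain S where S: "finite S" "\<And>a. a \<in> A \<Longrightarrow> \<exists>s\<in>S. a - s \<in> I"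
    using A unfolding finite_modulo_def by blast
  obtain T where T: "finite T" "\<And>b. b \<in> B \<Longrightarrow> \<exists>t\<in>T. b - t \<in> I"
    using B unfolding finite_modulo_def by blast
  show ?thesis
  proof (rule finite_moduloI)
    show "finite ((\<lambda>(s, t). s * t) ` (S \<times> T))"
      using S(1) T(1) by simp
  next
    fix p assume "p \<in> {a * b | a b. a \<in> A \<and> b \<in> B}"
    then obtain a b where ab: "p = a * b" "a \<in> A" "b \<in> B" by blast
    obtain s t where s: "s \<in> S" "a - s \<in> I" and t: "t \<in> T" "b - t \<in> I"
      using S(2)[OF ab(2)] T(2)[OF ab(3)] by blast
    have "a * (b - t) + t * (a - s) \<in> I"
      by (intro ring_module.subspace_add[OF I] ring_module.subspace_scale[OF I] s t)
    moreover have "a * (b - t) + t * (a - s) = p - s * t"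
      by (simp add: ab(1) algebra_simps)
    ultimately have "p - s * t \<in> I" by simp
    then show "\<exists>u\<in>(\<lambda>(s, t). s * t) ` (S \<times> T). p - u \<in> I"
      using s(1) t(1) by auto
  qed
qed

lemma finite_modulo_prod:
  fixes I :: "'r::comm_ring_1 set"
  assumes I: "ring_module.subspace I" and "finite J" and "\<And>i. i \<in> J \<Longrightarrow> finite_modulo I (A i)"
  shows "finite_modulo I {\<Prod>i\<in>J. a i | a. \<forall>i\<in>J. a i \<in> A i}"
  using assms(2,3)
proof (induction J rule: finite_induct)
  case empty
  show ?case
    by (rule finite_moduloI[where T = "{1}"]) (auto simp: ring_module.subspace_0[OF I])
next
  case (insert j J)
  have "finite_modulo I {a * b | a b. a \<in> A j \<and> b \<in> {\<Prod>i\<in>J. a i | a. \<forall>i\<in>J. a i \<in> A i}}"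
    by (intro finite_modulo_times[OF I] insert) (use insert in auto)
  moreover have "{\<Prod>i\<in>insert j J. a i | a. \<forall>i\<in>insert j J. a i \<in> A i}
      \<subseteq> {a * b | a b. a \<in> A j \<and> b \<in> {\<Prod>i\<in>J. a i | a. \<forall>i\<in>J. a i \<in> A i}}"
    using insert.hyps by auto
  ultimately show ?case
    unfolding finite_modulo_def by (meson subsetD)
qed

section \<open>Monomials and univariate polynomials in one variable\<close>

lemma mconst_0 [simp]: "mconst 0 = 0"
  by (simp add: mconst_def)

lemma mconst_1 [simp]: "mconst 1 = 1"
  by (simp add: mconst_def)

lemma mconst_add: "mconst (a + b) = mconst a + mconst b"
  by (simp add: mconst_def single_add)

lemma mconst_mult: "mconst (a * b) = mconst a * (mconst b :: ('n, 'a::comm_ring_1) mpoly)"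
  by (simp add: mconst_def mult_single)

lemma mvar_power:
  "mvar i ^ k = (Poly_Mapping.single (Poly_Mapping.single i k) 1 :: ('n, 'a::comm_ring_1) mpoly)"
proof (induction k)
  case (Suc k)
  have "Poly_Mapping.single i 1 + Poly_Mapping.single i k = Poly_Mapping.single i (Suc k)"
    by (simp flip: single_add)
  with Suc show ?case
    by (simp add: mvar_def mult_single)
qed simp

lemma prod_single_1:
  "(\<Prod>i\<in>J. Poly_Mapping.single (e i) 1)
    = (Poly_Mapping.single (\<Sum>i\<in>J. e i) 1 :: ('n, 'a::comm_ring_1) mpoly)"
  by (induction J rule: infinite_finite_induct) (simp_all add: mult_single)

lemma single_eq_mconst_times_prod_mvar:
  fixes e :: "'n::finite \<Rightarrow>\<^sub>0 nat" and c :: "'a::comm_ring_1"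
  shows "Poly_Mapping.single e c = mconst c * (\<Prod>i\<in>UNIV. mvar i ^ Poly_Mapping.lookup e i)"
proof -
  have "(\<Sum>i\<in>UNIV. Poly_Mapping.single i (Poly_Mapping.lookup e i)) = e"
    by (rule poly_mapping_eqI) (simp add: lookup_sum lookup_single when_def)
  then show ?thesis
    by (simp add: mvar_power prod_single_1 mconst_def mult_single)
qed

lemma poly_mapping_zero_plus_single_induct [case_names zero plus_single]:
  assumes "P 0" and "\<And>p e c. P p \<Longrightarrow> P (p + Poly_Mapping.single e (c :: 'c::monoid_add))"
  shows "P p"
proof (induction p rule: update_induct)
  case (update p e c)
  have "Poly_Mapping.update e c p = p + Poly_Mapping.single e c"
    using update(1)
    by (intro poly_mapping_eqI)
      (auto simp: lookup_update lookup_add lookup_single when_def in_keys_iff)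
  then show ?case
    using assms(2) update(3) by simp
qed (fact assms(1))

lemma poly_in_var_0 [simp]: "poly_in_var 0 i = 0"
  by (simp add: poly_in_var_def)

lemma poly_in_var_pCons: "poly_in_var (pCons a p) i = mconst a + mvar i * poly_in_var p i"
  by (simp add: poly_in_var_def map_poly_pCons)

lemma poly_in_var_add: "poly_in_var (p + r) i = poly_in_var p i + poly_in_var r i"
proof (induction p arbitrary: r)
  case (pCons a p)
  obtain b s where "r = pCons b s" by (cases r)
  then show ?case
    by (simp add: pCons.IH poly_in_var_pCons mconst_add distrib_left add_ac)
qed simp

lemma poly_in_var_smult: "poly_in_var (smult a p) i = mconst a * poly_in_var p i"
proof (induction p)
  case (pCons b p)
  have "poly_in_var (smult a (pCons b p)) i = mconst (a * b) + mvar i * (mconst a * poly_in_var p i)"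
    by (simp only: smult_pCons poly_in_var_pCons pCons.IH)
  also have "\<dots> = mconst a * (mconst b + mvar i * poly_in_var p i)"
    by (simp only: mconst_mult distrib_left mult.left_commute)
  finally show ?case
    by (simp only: poly_in_var_pCons)
qed simp

lemma poly_in_var_mult: "poly_in_var (p * r) i = poly_in_var p i * poly_in_var r i"
proof (induction p)
  case (pCons a p)
  have "poly_in_var (pCons a p * r) i
      = mconst a * poly_in_var r i + mvar i * (poly_in_var p i * poly_in_var r i)"
    by (simp add: mult_pCons_left poly_in_var_add poly_in_var_smult poly_in_var_pCons pCons.IH)
  then show ?case
    by (simp only: poly_in_var_pCons distrib_right mult.assoc)
qed simp

lemma poly_in_var_monom: "poly_in_var (monom 1 k) i = mvar i ^ k"
  by (induction k)
    (simp_all add: monom_0 monom_Suc poly_in_var_pCons)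

lemma finite_poly_degree_le: "finite {p :: 'a::{finite, zero} poly. degree p \<le> n}"
proof (rule finite_subset)
  show "{p :: 'a poly. degree p \<le> n} \<subseteq> Poly ` {xs. set xs \<subseteq> UNIV \<and> length xs \<le> Suc n}"
  proof
    fix p :: "'a poly"
    assume "p \<in> {p. degree p \<le> n}"
    then have "length (coeffs p) \<le> Suc n"
      by (cases "p = 0") (simp_all add: length_coeffs_degree)
    then show "p \<in> Poly ` {xs. set xs \<subseteq> UNIV \<and> length xs \<le> Suc n}"
      by (intro image_eqI[where x = "coeffs p"]) simp_all
  qed
  show "finite (Poly ` {xs :: 'a list. set xs \<subseteq> UNIV \<and> length xs \<le> Suc n})"
    by (intro finite_imageI finite_lists_length_le) simp
qed

section \<open>Residues modulo an ideal with a univariate polynomial for each variable\<close>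

text \<open>
  Division with remainder by \<open>f\<close> makes every power of \<open>X\<^sub>i\<close> congruent to the value at \<open>X\<^sub>i\<close> of a
  polynomial of degree at most that of \<open>f\<close>, and there are only finitely many of these.
\<close>

lemma finite_modulo_mvar_powers:
  fixes f :: "'a::{field, finite} poly" and I :: "('n, 'a) mpoly set"
  assumes I: "ring_module.subspace I" and "f \<noteq> 0" and f: "poly_in_var f i \<in> I"
  shows "finite_modulo I (range (\<lambda>k. mvar i ^ k))"
proof (rule finite_moduloI)
  show "finite ((\<lambda>p. poly_in_var p i :: ('n, 'a) mpoly) ` {p. degree p \<le> degree f})"
    by (intro finite_imageI finite_poly_degree_le)
next
  fix s :: "('n, 'a) mpoly"
  assume "s \<in> range (\<lambda>k. mvar i ^ k)"
  then obtain k where s: "s = mvar i ^ k" by blast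
  define p :: "'a poly" where "p = monom 1 k"
  have "s = poly_in_var (p div f * f + p mod f) i"
    by (simp add: s p_def poly_in_var_monom)
  then have "s - poly_in_var (p mod f) i = poly_in_var (p div f) i * poly_in_var f i"
    by (simp only: poly_in_var_add poly_in_var_mult add_diff_cancel_right')
  also have "\<dots> \<in> I"
    by (rule ring_module.subspace_scale[OF I f])
  finally have "s - poly_in_var (p mod f) i \<in> I" .
  moreover have "degree (p mod f) \<le> degree f"
    using degree_mod_less[OF \<open>f \<noteq> 0\<close>, of p] by auto
  ultimately show "\<exists>t\<in>(\<lambda>p. poly_in_var p i) ` {p. degree p \<le> degree f}. s - t \<in> I"
    by blast
qed

text \<open>
  If \<open>T\<close> represents the residues of the monomials, the linear combinations of \<open>T\<close> represent those of
  all polynomials, and over a finite field there are only finitely many such combinations.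
\<close>

lemma finite_modulo_univ:
  fixes f :: "'n::finite \<Rightarrow> 'a::{field, finite} poly" and I :: "('n, 'a) mpoly set"
  assumes I: "ring_module.subspace I" and nz: "\<And>i. f i \<noteq> 0" and f: "\<And>i. poly_in_var (f i) i \<in> I"
  shows "finite_modulo I UNIV"
proof -
  have "finite_modulo I {\<Prod>i\<in>UNIV. a i | a. \<forall>i\<in>UNIV. a i \<in> range (\<lambda>k. mvar i ^ k)}"
    by (rule finite_modulo_prod[OF I finite_UNIV]) (rule finite_modulo_mvar_powers[OF I nz f])
  then obtain T where fin: "finite T" and
    "\<forall>s\<in>{\<Prod>i\<in>UNIV. a i | a. \<forall>i\<in>UNIV. a i \<in> range (\<lambda>k. mvar i ^ k)}. \<exists>t\<in>T. s - t \<in> I"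
    unfolding finite_modulo_def by (elim exE conjE)
  then have T: "\<exists>t\<in>T. (\<Prod>i\<in>UNIV. mvar i ^ k i) - t \<in> I" for k
    by (elim bspec) (intro CollectI exI[of _ "\<lambda>i. mvar i ^ k i"], simp)
  define comb :: "(('n, 'a) mpoly \<Rightarrow> 'a) \<Rightarrow> ('n, 'a) mpoly"
    where "comb g = (\<Sum>t\<in>T. mconst (g t) * t)" for g
  show ?thesis
  proof (rule finite_moduloI)
    show "finite (comb ` (T \<rightarrow>\<^sub>E UNIV))"
      by (intro finite_imageI finite_PiE fin) simp
  next
    fix p :: "('n, 'a) mpoly"
    have "\<exists>g. p - comb g \<in> I"
    proof (induction p rule: poly_mapping_zero_plus_single_induct)
      case zero
      have "comb (\<lambda>_. 0) = 0"
        by (simp add: comb_def)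
      then show ?case
        by (intro exI[of _ "\<lambda>_. 0"]) (simp add: ring_module.subspace_0[OF I])
    next
      case (plus_single p e c)
      then obtain g where g: "p - comb g \<in> I" by blast
      obtain t where t: "t \<in> T" "(\<Prod>i\<in>UNIV. mvar i ^ Poly_Mapping.lookup e i) - t \<in> I"
        using T[of "Poly_Mapping.lookup e"] by (elim bexE)
      define h where "h u = (if u = t then c else 0)" for u
      have "comb h = (\<Sum>u\<in>T. if u = t then mconst c * t else 0)"
        unfolding comb_def h_def by (rule sum.cong) simp_all
      also have "\<dots> = mconst c * t"
        using fin t(1) by simp
      finally have h: "comb h = mconst c * t" .
      have "(p - comb g) + mconst c * ((\<Prod>i\<in>UNIV. mvar i ^ Poly_Mapping.lookup e i) - t) \<in> I"
        by (intro ring_module.subspace_add[OF I g] ring_module.subspace_scale[OF I t(2)])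
      moreover have "comb (\<lambda>u. g u + h u) = comb g + comb h"
        by (simp only: comb_def mconst_add distrib_right sum.distrib)
      ultimately have "(p + Poly_Mapping.single e c) - comb (\<lambda>u. g u + h u) \<in> I"
        by (simp only: h single_eq_mconst_times_prod_mvar right_diff_distrib add_diff_add)
      then show ?case by blast
    qed
    then obtain g where g: "p - comb g \<in> I" by blast
    \<comment> \<open>Only the coefficients on \<open>T\<close> count, which leaves finitely many combinations.\<close>
    moreover have "comb (restrict g T) = comb g"
      unfolding comb_def by (rule sum.cong) simp_all
    ultimately show "\<exists>t\<in>comb ` (T \<rightarrow>\<^sub>E UNIV). p - t \<in> I"
      by (intro bexI[of _ "comb (restrict g T)"] imageI) auto
  qed
qed

theorem theorem4:
  fixes q :: nat
    and f :: "'n::finite \<Rightarrow> 'a::{field, finite} poly"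
  assumes "CHAR('a) = q"
    and "\<And>i. f i \<noteq> 0"
    and "card {i. degree (f i) \<noteq> 0} \<le> 1"
  shows "IP_star_set (ideal_generated (range (\<lambda>i. poly_in_var (f i) i)))"
proof -
  let ?I = "ideal_generated (range (\<lambda>i. poly_in_var (f i) i))"
  have I: "ring_module.subspace ?I"
    unfolding ideal_generated_def by (rule ring_module.subspace_span)
  have gen: "poly_in_var (f i) i \<in> ?I" for i
    unfolding ideal_generated_def by (intro ring_module.span_base rangeI)
  show ?thesis
  proof (rule IP_star_set_if_finite_index)
    show "x - y \<in> ?I" if "x \<in> ?I" "y \<in> ?I" for x y
      by (rule ring_module.subspace_diff[OF I that])
    show "finite_modulo ?I UNIV"
      by (rule finite_modulo_univ[OF I assms(2) gen])
  qed
qed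

end
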